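(* Let $H$ be the Heisenberg group of unitriangular $3\times 3$ integer matrices, let $\mathcal{H}=\mathbb{C}[H]$ be its group algebra, and let $\sigma,\tau$ be inner automorphisms of $H$, $\sigma(u)=\tilde\sigma u\tilde\sigma^{-1}$, $\tau(u)=\tilde\tau u\tilde\tau^{-1}$ for fixed $\tilde\sigma,\tilde\tau\in H$. Then every $(\sigma,\tau)$-conjugacy class in $H$ either consists of one element or is infinite, and $$\mathcal{D}_{(\sigma,\tau)}(\mathcal{H})=ZDer_{\sigma,\tau}\oplus QInn,$$ where $ZDer_{\sigma,\tau}$ is the space of $(\sigma,\tau)$-central $(\sigma,\tau)$-derivations and $QInn$ is the space of quasi-inner $(\sigma,\tau)$-derivations of $\mathcal{H}$.
   Context: Write $G=H$. The endomorphisms $\sigma,\tau$ are extended linearly to $\mathbb{C}[G]$. A $(\sigma,\tau)$-derivation is a $\mathbb{C}$-linear map $D:\mathbb{C}[G]\to\mathbb{C}[G]$ with $D(ab)=D(a)\tau(b)+\sigma(a)D(b)$; $\mathcal{D}_{(\sigma,\tau)}(\mathbb{C}[G])$ is the vector space of all of them. The $(\sigma,\tau)$-conjugacy class of $a\in G$ is $\{\sigma(v)a\tau(v^{-1}) : v\in G\}$. An element $a\in G$ is $(\sigma,\tau)$-central if $a\tau(v)=\sigma(v)a$ for all $v\in G$. For a $(\sigma,\tau)$-central $a$ and a homomorphism $\varphi:G\to(\mathbb{C},+)$, the linear map defined on $g\in G$ by $D(g)=\varphi(g)\sigma(g)a$ is a $(\sigma,\tau)$-derivation, called $(\sigma,\tau)$-central;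 $ZDer_{\sigma,\tau}$ denotes the linear span of these. The groupoid $\Gamma$ has object set $G$ and $\operatorname{Hom}(a,b)=\{(u,v)\in G\times G : \sigma(v^{-1})u=a,\ u\tau(v^{-1})=b\}$. A $(\sigma,\tau)$-derivation $D$ with $D(g)=\sum_h\lambda_g^h h$ is quasi-inner if $\lambda_g^h=0$ whenever $(h,g)$ is a loop of $\Gamma$, i.e. $(h,g)\in\operatorname{Hom}(a,a)$ for some $a\in G$. *)

theory Defs
  imports
    "HOL-Analysis.Cartesian_Space"
    "HOL-Library.Poly_Mapping"
    "HOL-Library.Function_Algebras"
begin

section \<open>The Heisenberg group\<close>

text \<open>
  The rows and columns are named explicitly: in the order on the index type \<open>3\<close> the numeral
  \<open>3\<close> is the least element, so \<open>i < j\<close> would not describe the part above the diagonal.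
\<close>

typedef heis =
  "{A :: int^3^3. A$1$1 = 1 \<and> A$2$2 = 1 \<and> A$3$3 = 1 \<and> A$2$1 = 0 \<and> A$3$1 = 0 \<and> A$3$2 = 0}"
  by (rule exI[of _ "mat 1"]) (simp add: mat_def)

text \<open>
  Matrix multiplication is written additively, since the class of not necessarily commutative
  groups is \<^class>\<open>group_add\<close> and the convolution product on \<open>'g \<Rightarrow>\<^sub>0 complex\<close>
  (the product of the group algebra) is set up for an additive monoid \<open>'g\<close>. Thus the product
  $uv$ is \<open>u + v\<close>, the inverse of $v$ is \<open>- v\<close>, and the unit is \<open>0\<close>.
\<close>

instantiation heis :: group_add
begin

definition zero_heis :: heis where
  "0 = Abs_heis (mat 1)"

definition plus_heis :: "heis \<Rightarrow> heis \<Rightarrow> heis" where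
  "A + B = Abs_heis (Rep_heis A ** Rep_heis B)"

definition uminus_heis :: "heis \<Rightarrow> heis" where
  "- A = Abs_heis (\<chi> i j.
     if i = 1 \<and> j = 2 then - Rep_heis A $ 1 $ 2
     else if i = 2 \<and> j = 3 then - Rep_heis A $ 2 $ 3
     else if i = 1 \<and> j = 3 then Rep_heis A $ 1 $ 2 * Rep_heis A $ 2 $ 3 - Rep_heis A $ 1 $ 3
     else if i = j then 1 else 0)"

definition minus_heis :: "heis \<Rightarrow> heis \<Rightarrow> heis" where
  "A - B = A + - (B :: heis)"

lemma Rep_zero_heis: "Rep_heis 0 = mat 1"
  unfolding zero_heis_def by (subst Abs_heis_inverse) (simp_all add: mat_def)

lemma Rep_plus_heis: "Rep_heis (A + B) = Rep_heis A ** Rep_heis B"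
  unfolding plus_heis_def using Rep_heis[of A] Rep_heis[of B]
  by (subst Abs_heis_inverse) (simp_all add: matrix_matrix_mult_def sum_3)

lemma uminus_heis_left: "- A + A = (0 :: heis)"
proof -
  have "Rep_heis (- A) ** Rep_heis A = mat 1"
    unfolding uminus_heis_def using Rep_heis[of A]
    by (subst Abs_heis_inverse)
      (simp_all add: matrix_matrix_mult_def sum_3 mat_def vec_eq_iff forall_3 algebra_simps)
  then show ?thesis
    by (simp add: Rep_heis_inject[symmetric] Rep_plus_heis Rep_zero_heis)
qed

instance
proof
  fix A B C :: heis
  show "A + B + C = A + (B + C)"
    by (simp add: Rep_heis_inject[symmetric] Rep_plus_heis matrix_mul_assoc)
  show "0 + A = A" "A + 0 = A"
    by (simp_all add: Rep_heis_inject[symmetric] Rep_plus_heis Rep_zero_heis)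
  show "- A + A = 0" by (rule uminus_heis_left)
  show "A + - B = A - B" by (simp add: minus_heis_def)
qed

end

definition inner_automorphism :: "'g::group_add \<Rightarrow> 'g \<Rightarrow> 'g" where
  "inner_automorphism s u = s + u + (- s)"

section \<open>The group algebra and linear operators on it\<close>

type_synonym 'g group_algebra = "'g \<Rightarrow>\<^sub>0 complex"

definition ga_scale :: "complex \<Rightarrow> 'g group_algebra \<Rightarrow> 'g group_algebra" where
  "ga_scale c x = Poly_Mapping.map ((*) c) x"

definition basis :: "'g \<Rightarrow> 'g group_algebra" where
  "basis g = Poly_Mapping.single g 1"

lemma lookup_ga_scale [simp]: "Poly_Mapping.lookup (ga_scale c x) g = c * Poly_Mapping.lookup x g"
  by (simp add: ga_scale_def Poly_Mapping.map.rep_eq when_def)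

global_interpretation ga: vector_space "ga_scale :: complex \<Rightarrow> 'g group_algebra \<Rightarrow> _"
  by unfold_locales (auto intro!: poly_mapping_eqI simp: lookup_add algebra_simps)

definition op_scale ::
  "complex \<Rightarrow> ('g group_algebra \<Rightarrow> 'g group_algebra) \<Rightarrow> 'g group_algebra \<Rightarrow> 'g group_algebra" where
  "op_scale c D = (\<lambda>x. ga_scale c (D x))"

global_interpretation op: vector_space
  "op_scale :: complex \<Rightarrow> ('g group_algebra \<Rightarrow> 'g group_algebra) \<Rightarrow> _"
  by unfold_locales (auto simp: op_scale_def fun_eq_iff ga.scale_right_distrib ga.scale_left_distrib)

definition lin_ext :: "('g \<Rightarrow> 'g group_algebra) \<Rightarrow> 'g group_algebra \<Rightarrow> 'g group_algebra" where
  "lin_ext F x = (\<Sum>g\<in>Poly_Mapping.keys x. ga_scale (Poly_Mapping.lookup x g) (F g))"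

lemma lin_ext_basis: "lin_ext F (basis g) = F g"
  by (simp add: lin_ext_def basis_def)

lemma linear_lin_ext: "Vector_Spaces.linear ga_scale ga_scale (lin_ext F)"
proof -
  have ext: "lin_ext F x = (\<Sum>g\<in>S. ga_scale (Poly_Mapping.lookup x g) (F g))"
    if "finite S" "Poly_Mapping.keys x \<subseteq> S" for x :: "'a group_algebra" and S
    unfolding lin_ext_def using that
    by (intro sum.mono_neutral_left) (auto simp: in_keys_iff)
  have add: "lin_ext F (x + y) = lin_ext F x + lin_ext F y" for x y
  proof -
    let ?S = "Poly_Mapping.keys x \<union> Poly_Mapping.keys y"
    have "Poly_Mapping.keys (x + y) \<subseteq> ?S" by (rule keys_add)
    then show ?thesis
      by (simp add: ext[of ?S] lookup_add ga.scale_left_distrib sum.distrib)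
  qed
  have scale: "lin_ext F (ga_scale c x) = ga_scale c (lin_ext F x)" for c x
  proof -
    have "Poly_Mapping.keys (ga_scale c x) \<subseteq> Poly_Mapping.keys x" by (auto simp: in_keys_iff)
    then show ?thesis
      by (simp add: ext[of "Poly_Mapping.keys x"] ga.scale_sum_right)
  qed
  show ?thesis
    by unfold_locales (simp_all add: add scale)
qed

definition extend_hom :: "('g \<Rightarrow> 'g) \<Rightarrow> 'g group_algebra \<Rightarrow> 'g group_algebra" where
  "extend_hom \<sigma> = lin_ext (\<lambda>g. basis (\<sigma> g))"

section \<open>Twisted derivations\<close>

definition derivations ::
  "('g::group_add \<Rightarrow> 'g) \<Rightarrow> ('g \<Rightarrow> 'g) \<Rightarrow> ('g group_algebra \<Rightarrow> 'g group_algebra) set" where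
  "derivations \<sigma> \<tau> = {D. Vector_Spaces.linear ga_scale ga_scale D \<and>
     (\<forall>a b. D (a * b) = D a * extend_hom \<tau> b + extend_hom \<sigma> a * D b)}"

definition twisted_conj_class ::
  "('g::group_add \<Rightarrow> 'g) \<Rightarrow> ('g \<Rightarrow> 'g) \<Rightarrow> 'g \<Rightarrow> 'g set" where
  "twisted_conj_class \<sigma> \<tau> a = range (\<lambda>v. \<sigma> v + a + \<tau> (- v))"

definition twisted_central ::
  "('g::group_add \<Rightarrow> 'g) \<Rightarrow> ('g \<Rightarrow> 'g) \<Rightarrow> 'g \<Rightarrow> bool" where
  "twisted_central \<sigma> \<tau> a \<longleftrightarrow> (\<forall>v. a + \<tau> v = \<sigma> v + a)"

definition central_derivation ::
  "('g::group_add \<Rightarrow> 'g) \<Rightarrow> 'g \<Rightarrow> ('g \<Rightarrow> complex) \<Rightarrow> 'g group_algebra \<Rightarrow> 'g group_algebra" where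
  "central_derivation \<sigma> a \<phi> = lin_ext (\<lambda>g. ga_scale (\<phi> g) (basis (\<sigma> g + a)))"

definition ZDer ::
  "('g::group_add \<Rightarrow> 'g) \<Rightarrow> ('g \<Rightarrow> 'g) \<Rightarrow> ('g group_algebra \<Rightarrow> 'g group_algebra) set" where
  "ZDer \<sigma> \<tau> = op.span {central_derivation \<sigma> a \<phi> | a \<phi>.
     twisted_central \<sigma> \<tau> a \<and> (\<forall>u v. \<phi> (u + v) = \<phi> u + \<phi> v)}"

definition groupoid_Hom ::
  "('g::group_add \<Rightarrow> 'g) \<Rightarrow> ('g \<Rightarrow> 'g) \<Rightarrow> 'g \<Rightarrow> 'g \<Rightarrow> ('g \<times> 'g) set" where
  "groupoid_Hom \<sigma> \<tau> a b = {(u, v). \<sigma> (- v) + u = a \<and> u + \<tau> (- v) = b}"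

definition QInn ::
  "('g::group_add \<Rightarrow> 'g) \<Rightarrow> ('g \<Rightarrow> 'g) \<Rightarrow> ('g group_algebra \<Rightarrow> 'g group_algebra) set" where
  "QInn \<sigma> \<tau> = {D \<in> derivations \<sigma> \<tau>.
     \<forall>g h. (\<exists>a. (h, g) \<in> groupoid_Hom \<sigma> \<tau> a a) \<longrightarrow> Poly_Mapping.lookup (D (basis g)) h = 0}"

definition internal_direct_sum ::
  "('g group_algebra \<Rightarrow> 'g group_algebra) set \<Rightarrow> ('g group_algebra \<Rightarrow> 'g group_algebra) set \<Rightarrow>
   ('g group_algebra \<Rightarrow> 'g group_algebra) set \<Rightarrow> bool" where
  "internal_direct_sum V A B \<longleftrightarrow>
     op.subspace A \<and> op.subspace B \<and> V = {D + E | D E. D \<in> A \<and> E \<in> B} \<and> A \<inter> B = {0}"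

end

theory Submission
  imports Defs
begin

text \<open>
  A derivation \<open>D\<close> is encoded by the coefficients \<open>coef D a g\<close> of \<open>D g\<close> at \<open>\<sigma>(g) a\<close>. Let \<open>G\<close> act on
  itself by \<open>h \<cdot> a = \<sigma>(h) a \<tau>(h)\<inverse>\<close>; the orbits are the twisted conjugacy classes, the fixed points
  are the central elements, and a pair \<open>(\<sigma>(g) a, g)\<close> is a loop exactly when \<open>g\<close> stabilises \<open>a\<close>. The
  Leibniz rule becomes the cocycle identity \<open>coef a (g h) = coef (h \<cdot> a) g + coef a h\<close>
  (\<open>coef_add\<close>).

  At a central \<open>a\<close> the identity says that \<open>coef a\<close> is a homomorphism. As \<open>G\<close> is finitely generated
  and each \<open>D g\<close> has finite support, only finitely many of these homomorphisms are nonzero, so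
  they assemble to an element of \<open>ZDer\<close>. Removing it from \<open>D\<close> leaves a derivation whose coefficients
  at central elements vanish, and it is quasi-inner as soon as \<open>coef a g = 0\<close> for every
  \<open>a\<close> with infinite orbit and every \<open>g\<close> in the stabiliser of \<open>a\<close>.

  For that, the cocycle identity gives \<open>coef (h \<cdot> a) (h g h\<inverse>) = coef a g\<close>. If \<open>g\<close> is in the centre
  of \<open>G\<close>, this says that \<open>coef b g\<close> is constant for \<open>b\<close> in an infinite orbit, hence zero since \<open>D g\<close>
  is finitely supported. For general \<open>g\<close>, nilpotency of class two makes \<open>h g h\<inverse>\<close> differ from \<open>g\<close> by an
  element of the centre, at which the coefficients are already known to vanish; so \<open>coef b g\<close> is again
  constant along the orbit, and zero (\<open>coef_stabiliser_eq_0\<close>).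

  The argument applies to any finitely generated group of class two whose twisted conjugacy
  classes are singletons or infinite, with \<open>\<sigma>\<close> and \<open>\<tau>\<close> fixing the centre. For the Heisenberg group
  with inner \<open>\<sigma>\<close>, \<open>\<tau>\<close>, the twisted classes are \<open>s C t\<inverse>\<close> for ordinary conjugacy classes \<open>C\<close>, and the class of
  \<open>x\<close> is obtained by adding to the corner entry the values of a nonzero linear form unless \<open>x\<close> is
  in the centre.
\<close>

section \<open>Calculus in the group algebra\<close>

lemma lookup_basis: "Poly_Mapping.lookup (basis g) h = (if g = h then 1 else 0)"
  by (simp add: basis_def lookup_single when_def)

lemma basis_mult: "basis g * basis h = basis (g + h)"
  by (simp add: basis_def mult_single)

lemma lookup_mult_basis:
  fixes x :: "'g::group_add group_algebra"
  shows "Poly_Mapping.lookup (x * basis h) k = Poly_Mapping.lookup x (k - h)"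
proof -
  have "(\<Sum>q. (if h = q then 1 else 0 :: complex) when k = l + q) = (1 when l = k - h)" for l
  proof -
    have "(\<lambda>q. (if h = q then 1 else 0 :: complex) when k = l + q)
        = (\<lambda>q. (1 when l = k - h) when q = h)"
      by (auto simp: when_def fun_eq_iff)
    then show ?thesis by (simp only: Sum_any_when_equal)
  qed
  then show ?thesis by (simp add: lookup_mult lookup_basis mult_when)
qed

lemma lookup_basis_mult:
  fixes x :: "'g::group_add group_algebra"
  shows "Poly_Mapping.lookup (basis h * x) k = Poly_Mapping.lookup x (- h + k)"
proof -
  have "k = h + q \<longleftrightarrow> q = - h + k" for q
    by (metis add_minus_cancel minus_add_cancel)
  then have "(\<Sum>q. Poly_Mapping.lookup x q when k = h + q) = Poly_Mapping.lookup x (- h + k)"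
    by simp
  then show ?thesis
    by (simp add: lookup_mult basis_def lookup_single when_mult)
qed

lemma ga_scale_mult_left: "ga_scale c x * y = ga_scale c (x * y)"
  for x :: "'g::group_add group_algebra"
proof -
  have "ga_scale c x = Poly_Mapping.single 0 c * x" for x :: "'g group_algebra"
    by (rule poly_mapping_eqI) (simp add: lookup_mult lookup_single when_mult)
  then show ?thesis by (simp add: mult.assoc)
qed

lemma ga_scale_mult_right: "x * ga_scale c y = ga_scale c (x * y)"
  for x :: "'g::group_add group_algebra"
proof -
  have "ga_scale c y = y * Poly_Mapping.single 0 c" for y :: "'g group_algebra"
  proof (rule poly_mapping_eqI)
    fix k :: 'g
    have "Sum_any (\<lambda>q. (c when 0 = q) when k = l + q) = (c when l = k)" for l :: 'g
    proof -
      have "(\<lambda>q. (c when 0 = q) when k = l + q) = (\<lambda>q. (c when l = k) when q = 0)"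
        by (auto simp: when_def fun_eq_iff)
      then show ?thesis by (simp only: Sum_any_when_equal)
    qed
    then show "Poly_Mapping.lookup (ga_scale c y) k = Poly_Mapping.lookup (y * Poly_Mapping.single 0 c) k"
      by (simp add: lookup_mult lookup_single mult_when mult.commute)
  qed
  then show ?thesis by (simp add: mult.assoc)
qed

lemma group_algebra_induct [case_names zero basis add scale]:
  assumes "P 0" and "\<And>g. P (basis g)" and "\<And>x y. P x \<Longrightarrow> P y \<Longrightarrow> P (x + y)"
    and "\<And>c x. P x \<Longrightarrow> P (ga_scale c x)"
  shows "P (x :: 'g group_algebra)"
proof -
  have expand: "x = (\<Sum>g\<in>Poly_Mapping.keys x. ga_scale (Poly_Mapping.lookup x g) (basis g))"
    by (rule poly_mapping_eqI) (auto simp: lookup_sum lookup_basis in_keys_iff if_distrib cong: if_cong)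
  have "P (\<Sum>g\<in>S. ga_scale (Poly_Mapping.lookup x g) (basis g))" for S
    using assms by (induction S rule: infinite_finite_induct) auto
  then show ?thesis by (subst expand)
qed

lemma extend_hom_basis: "extend_hom \<sigma> (basis g) = basis (\<sigma> g)"
  by (simp add: extend_hom_def lin_ext_basis)

lemma linear_extend_hom: "Vector_Spaces.linear ga_scale ga_scale (extend_hom \<sigma>)"
  unfolding extend_hom_def by (rule linear_lin_ext)

lemma linear_eq_0_if_basis:
  assumes "Vector_Spaces.linear ga_scale ga_scale D" and "\<And>g. D (basis g) = 0"
  shows "D = 0"
proof
  interpret D: Vector_Spaces.linear ga_scale ga_scale D by fact
  show "D x = 0 x" for x
    by (induction x rule: group_algebra_induct) (simp_all add: assms(2) D.zero D.add D.scale)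
qed

lemma derivationsI_basis:
  fixes D :: "'g::group_add group_algebra \<Rightarrow> 'g group_algebra"
  assumes "Vector_Spaces.linear ga_scale ga_scale D"
    and leibniz: "\<And>g h. D (basis (g + h)) = D (basis g) * basis (\<tau> h) + basis (\<sigma> g) * D (basis h)"
  shows "D \<in> derivations \<sigma> \<tau>"
proof -
  interpret D: Vector_Spaces.linear ga_scale ga_scale D by fact
  interpret S: Vector_Spaces.linear ga_scale ga_scale "extend_hom \<sigma>" by (rule linear_extend_hom)
  interpret T: Vector_Spaces.linear ga_scale ga_scale "extend_hom \<tau>" by (rule linear_extend_hom)
  have 1: "D (basis g * y) = D (basis g) * extend_hom \<tau> y + extend_hom \<sigma> (basis g) * D y" for g y
    by (induction y rule: group_algebra_induct)
      (simp_all add: D.zero D.add D.scale T.zero T.add T.scale basis_mult leibniz extend_hom_basis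
        ga_scale_mult_right ga.scale_right_distrib distrib_left)
  have "D (x * y) = D x * extend_hom \<tau> y + extend_hom \<sigma> x * D y" for x y
    by (induction x rule: group_algebra_induct)
      (simp_all add: 1 D.zero D.add D.scale S.zero S.add S.scale
        ga_scale_mult_left ga.scale_right_distrib distrib_right)
  with assms(1) show ?thesis by (simp add: derivations_def)
qed

lemma subspace_derivations: "op.subspace (derivations \<sigma> \<tau>)"
  for \<sigma> :: "'g::group_add \<Rightarrow> 'g"
proof (rule op.subspaceI)
  show "0 \<in> derivations \<sigma> \<tau>"
    by (auto simp: derivations_def Vector_Spaces.linear_iff ga.vector_space_axioms)
next
  fix D E :: "'g group_algebra \<Rightarrow> 'g group_algebra"
  assume "D \<in> derivations \<sigma> \<tau>" "E \<in> derivations \<sigma> \<tau>"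
  then show "D + E \<in> derivations \<sigma> \<tau>"
    by (simp add: derivations_def Vector_Spaces.linear_iff ga.scale_right_distrib distrib_left distrib_right
        add_ac)
next
  fix c and D :: "'g group_algebra \<Rightarrow> 'g group_algebra"
  assume "D \<in> derivations \<sigma> \<tau>"
  then show "op_scale c D \<in> derivations \<sigma> \<tau>"
    by (simp add: derivations_def Vector_Spaces.linear_iff op_scale_def ga.scale_right_distrib
        ga_scale_mult_left ga_scale_mult_right mult.commute)
qed

section \<open>Coefficients of a twisted derivation\<close>

text \<open>
  Indexing the coefficients of \<open>D g\<close> by \<open>a\<close>, where the group element is \<open>\<sigma>(g) a\<close>, makes a central
  derivation concentrated at a single index.
\<close>

definition coef :: "('g::group_add \<Rightarrow> 'g) \<Rightarrow> ('g group_algebra \<Rightarrow> 'g group_algebra) \<Rightarrow> 'g \<Rightarrow> 'g \<Rightarrow> complex"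
  where "coef \<sigma> D a g = Poly_Mapping.lookup (D (basis g)) (\<sigma> g + a)"

lemma finite_coef_nonzero: "finite {a. coef \<sigma> D a g \<noteq> 0}"
proof (rule finite_subset)
  show "{a. coef \<sigma> D a g \<noteq> 0} \<subseteq> (\<lambda>h. - \<sigma> g + h) ` Poly_Mapping.keys (D (basis g))"
  proof
    fix a assume "a \<in> {a. coef \<sigma> D a g \<noteq> 0}"
    then have "\<sigma> g + a \<in> Poly_Mapping.keys (D (basis g))"
      by (simp add: coef_def in_keys_iff)
    then show "a \<in> (\<lambda>h. - \<sigma> g + h) ` Poly_Mapping.keys (D (basis g))"
      by (rule rev_image_eqI) simp
  qed
qed simp

lemma coef_0: "coef \<sigma> 0 a g = 0"
  by (simp add: coef_def)

lemma coef_plus: "coef \<sigma> (D + E) a g = coef \<sigma> D a g + coef \<sigma> E a g"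
  by (simp add: coef_def lookup_add)

lemma coef_minus: "coef \<sigma> (D - E) a g = coef \<sigma> D a g - coef \<sigma> E a g"
  by (simp add: coef_def lookup_minus)

lemma coef_scale: "coef \<sigma> (op_scale c D) a g = c * coef \<sigma> D a g"
  by (simp add: coef_def op_scale_def)

lemma coef_sum: "coef \<sigma> (sum D A) a g = (\<Sum>b\<in>A. coef \<sigma> (D b) a g)"
  by (induction A rule: infinite_finite_induct) (simp_all add: coef_def lookup_add)

lemma coef_central_derivation:
  "coef \<sigma> (central_derivation \<sigma> a \<phi>) b g = (if a = b then \<phi> g else 0)"
  by (simp add: coef_def central_derivation_def lin_ext_basis lookup_basis)

lemma lookup_eq_coef: "Poly_Mapping.lookup (D (basis g)) h = coef \<sigma> D (- \<sigma> g + h) g"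
  by (simp add: coef_def)

lemma eq_0_if_coef_eq_0:
  assumes "D \<in> derivations \<sigma> \<tau>" and "\<And>a g. coef \<sigma> D a g = 0"
  shows "D = 0"
proof (rule linear_eq_0_if_basis)
  show "Vector_Spaces.linear ga_scale ga_scale D"
    using assms(1) by (simp add: derivations_def)
  show "D (basis g) = 0" for g
    by (rule poly_mapping_eqI) (simp add: lookup_eq_coef[of _ _ _ \<sigma>] assms(2))
qed

section \<open>Derivations twisted by two endomorphisms\<close>

locale twisting =
  fixes \<sigma> \<tau> :: "'g::group_add \<Rightarrow> 'g"
  assumes \<sigma>_add: "\<sigma> (u + v) = \<sigma> u + \<sigma> v" and \<tau>_add: "\<tau> (u + v) = \<tau> u + \<tau> v"
begin

lemma \<sigma>_zero [simp]: "\<sigma> 0 = 0"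
  using \<sigma>_add[of 0 0] by (metis add_0_right add_left_cancel)

lemma \<tau>_zero [simp]: "\<tau> 0 = 0"
  using \<tau>_add[of 0 0] by (metis add_0_right add_left_cancel)

lemma \<sigma>_minus: "\<sigma> (- u) = - \<sigma> u"
  using \<sigma>_add[of "- u" u] by (simp add: eq_neg_iff_add_eq_0)

lemma \<tau>_minus: "\<tau> (- u) = - \<tau> u"
  using \<tau>_add[of "- u" u] by (simp add: eq_neg_iff_add_eq_0)

definition act :: "'g \<Rightarrow> 'g \<Rightarrow> 'g" where
  "act h a = \<sigma> h + a + \<tau> (- h)"

lemma act_add: "act (g + h) a = act g (act h a)"
  unfolding act_def minus_add \<sigma>_add \<tau>_add by (simp only: add.assoc)

lemma twisted_conj_class_eq_orbit: "twisted_conj_class \<sigma> \<tau> a = range (\<lambda>h. act h a)"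
  by (simp add: twisted_conj_class_def act_def)

lemma twisted_conj_class_act: "twisted_conj_class \<sigma> \<tau> (act h a) = twisted_conj_class \<sigma> \<tau> a"
proof -
  have "act k a \<in> range (\<lambda>k. act k (act h a))" for k
    by (rule range_eqI[of _ _ "k - h"]) (simp flip: act_add)
  moreover have "act k (act h a) \<in> range (\<lambda>k. act k a)" for k
    by (rule range_eqI[of _ _ "k + h"]) (simp add: act_add)
  ultimately show ?thesis
    unfolding twisted_conj_class_eq_orbit by blast
qed

lemma twisted_central_iff_fixed: "twisted_central \<sigma> \<tau> a \<longleftrightarrow> (\<forall>v. act v a = a)"
proof -
  have "act v a = a \<longleftrightarrow> a + \<tau> v = \<sigma> v + a" for v
    by (simp add: act_def \<tau>_minus diff_eq_eq) metis
  then show ?thesis by (simp add: twisted_central_def)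
qed

lemma twisted_conj_class_central:
  "twisted_central \<sigma> \<tau> a \<Longrightarrow> twisted_conj_class \<sigma> \<tau> a = {a}"
  by (simp add: twisted_conj_class_eq_orbit twisted_central_iff_fixed)

lemma central_derivation_derivation:
  assumes "twisted_central \<sigma> \<tau> a" and \<phi>: "\<And>u v. \<phi> (u + v) = \<phi> u + \<phi> v"
  shows "central_derivation \<sigma> a \<phi> \<in> derivations \<sigma> \<tau>"
proof (rule derivationsI_basis)
  show "Vector_Spaces.linear ga_scale ga_scale (central_derivation \<sigma> a \<phi>)"
    unfolding central_derivation_def by (rule linear_lin_ext)
  have comm: "a + \<tau> h = \<sigma> h + a" for h
    using assms(1) by (simp add: twisted_central_def)
  show "central_derivation \<sigma> a \<phi> (basis (g + h)) = central_derivation \<sigma> a \<phi> (basis g) * basis (\<tau> h)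
      + basis (\<sigma> g) * central_derivation \<sigma> a \<phi> (basis h)" for g h
    by (simp add: central_derivation_def lin_ext_basis ga_scale_mult_left ga_scale_mult_right
        basis_mult \<sigma>_add \<phi> add.assoc comm ga.scale_left_distrib)
qed

lemma ZDer_subset_derivations: "ZDer \<sigma> \<tau> \<subseteq> derivations \<sigma> \<tau>"
  unfolding ZDer_def
  by (rule op.span_minimal) (auto intro: central_derivation_derivation subspace_derivations)

lemma coef_add:
  assumes "D \<in> derivations \<sigma> \<tau>"
  shows "coef \<sigma> D a (g + h) = coef \<sigma> D (act h a) g + coef \<sigma> D a h"
proof -
  have "D (basis (g + h)) = D (basis g) * basis (\<tau> h) + basis (\<sigma> g) * D (basis h)"
    using assms by (simp add: derivations_def extend_hom_basis flip: basis_mult)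
  then show ?thesis
    by (simp add: coef_def lookup_add lookup_mult_basis lookup_basis_mult \<sigma>_add act_def \<tau>_minus add.assoc
        flip: add_uminus_conv_diff)
qed

lemma coef_central_hom:
  assumes "D \<in> derivations \<sigma> \<tau>" and "twisted_central \<sigma> \<tau> a"
  shows "coef \<sigma> D a (g + h) = coef \<sigma> D a g + coef \<sigma> D a h"
  using coef_add[OF assms(1)] assms(2) by (simp add: twisted_central_iff_fixed)

text \<open>
  Along the orbit of \<open>a\<close> the homomorphisms on the stabilisers are transported by conjugation. Expand
  \<open>coef D a\<close> at \<open>h g = (h g h\<inverse>) h\<close> in the two possible ways: the terms \<open>coef (g \<cdot> a) h\<close> and
  \<open>coef a h\<close> cancel because \<open>g\<close> fixes \<open>a\<close>.
\<close>

lemma coef_conjugate: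
  assumes "D \<in> derivations \<sigma> \<tau>" and "act g a = a"
  shows "coef \<sigma> D (act h a) (h + g - h) = coef \<sigma> D a g"
  using coef_add[OF assms(1), of a h g] coef_add[OF assms(1), of a "h + g - h" h] assms(2)
  by simp

lemma QInn_iff:
  "D \<in> QInn \<sigma> \<tau> \<longleftrightarrow> D \<in> derivations \<sigma> \<tau> \<and> (\<forall>g a. act g a = a \<longrightarrow> coef \<sigma> D a g = 0)"
proof -
  have "(\<exists>b. (h, g) \<in> groupoid_Hom \<sigma> \<tau> b b) \<longleftrightarrow> act g (- \<sigma> g + h) = - \<sigma> g + h" for g h
    by (auto simp: groupoid_Hom_def act_def \<sigma>_minus add.assoc)
  moreover have "(\<forall>h. act g (- \<sigma> g + h) = - \<sigma> g + h \<longrightarrow> coef \<sigma> D (- \<sigma> g + h) g = 0)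
      \<longleftrightarrow> (\<forall>a. act g a = a \<longrightarrow> coef \<sigma> D a g = 0)" for g
    by (metis minus_add_cancel)
  ultimately show ?thesis
    by (simp add: QInn_def lookup_eq_coef[of _ _ _ \<sigma>])
qed

lemma subspace_QInn: "op.subspace (QInn \<sigma> \<tau>)"
proof (rule op.subspaceI)
  show "0 \<in> QInn \<sigma> \<tau>"
    using op.subspace_0[OF subspace_derivations] by (simp add: QInn_iff coef_0)
  show "D + E \<in> QInn \<sigma> \<tau>" if "D \<in> QInn \<sigma> \<tau>" "E \<in> QInn \<sigma> \<tau>" for D E
    using that op.subspace_add[OF subspace_derivations, of D \<sigma> \<tau> E] unfolding QInn_iff
    by (simp add: coef_plus)
  show "op_scale c D \<in> QInn \<sigma> \<tau>" if "D \<in> QInn \<sigma> \<tau>" for c D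
    using that op.subspace_scale[OF subspace_derivations, of D \<sigma> \<tau> c] unfolding QInn_iff
    by (simp add: coef_scale)
qed

lemma coef_ZDer_not_central:
  assumes "D \<in> ZDer \<sigma> \<tau>" and "\<not> twisted_central \<sigma> \<tau> a"
  shows "coef \<sigma> D a g = 0"
  using assms(1) unfolding ZDer_def
proof (induction rule: op.span_induct_alt)
  case base
  show ?case by (rule coef_0)
next
  case (step c D E)
  then show ?case
    unfolding coef_plus coef_scale
    using assms(2) by (auto simp: coef_central_derivation split: if_splits)
qed

lemma ZDer_Int_QInn: "ZDer \<sigma> \<tau> \<inter> QInn \<sigma> \<tau> = {0}"
proof -
  have "D = 0" if D: "D \<in> ZDer \<sigma> \<tau>" "D \<in> QInn \<sigma> \<tau>" for D
  proof (rule eq_0_if_coef_eq_0)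
    show "D \<in> derivations \<sigma> \<tau>" using D(2) by (simp add: QInn_iff)
    show "coef \<sigma> D a g = 0" for a g
      using D coef_ZDer_not_central[OF D(1)]
      by (cases "twisted_central \<sigma> \<tau> a") (simp_all add: QInn_iff twisted_central_iff_fixed)
  qed
  moreover have "0 \<in> ZDer \<sigma> \<tau>" unfolding ZDer_def by (rule op.span_zero)
  ultimately show ?thesis
    using op.subspace_0[OF subspace_QInn] by auto
qed

text \<open>A nonzero constant value would put infinitely many elements into the support of \<open>D g\<close>.\<close>

lemma coef_eq_0_if_constant_on_infinite_orbit:
  assumes inf: "infinite (twisted_conj_class \<sigma> \<tau> a)"
    and const: "\<And>h. coef \<sigma> D (act h a) g = coef \<sigma> D a g"
  shows "coef \<sigma> D a g = 0"
proof (rule ccontr)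
  assume "coef \<sigma> D a g \<noteq> 0"
  then have "twisted_conj_class \<sigma> \<tau> a \<subseteq> {b. coef \<sigma> D b g \<noteq> 0}"
    unfolding twisted_conj_class_eq_orbit by (simp add: image_subset_iff const)
  then have "finite (twisted_conj_class \<sigma> \<tau> a)"
    by (rule finite_subset) (rule finite_coef_nonzero)
  with inf show False by contradiction
qed

end

section \<open>Finitely generated groups of nilpotency class two\<close>

text \<open>
  The finite set \<open>S\<close> stands for a generating set; only the fact that homomorphisms to the complex
  numbers are determined on it enters.
\<close>

locale class_two_twisting = twisting \<sigma> \<tau> for \<sigma> \<tau> :: "'g::group_add \<Rightarrow> 'g" +
  fixes S :: "'g set"
  assumes commutator_central: "(h + g - h - g) + (k :: 'g) = k + (h + g - h - g)"
    and \<sigma>_centre: "(\<And>k. w + k = k + w) \<Longrightarrow> \<sigma> w = w"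
    and \<tau>_centre: "(\<And>k. w + k = k + w) \<Longrightarrow> \<tau> w = w"
    and central_or_infinite: "twisted_central \<sigma> \<tau> a \<or> infinite (twisted_conj_class \<sigma> \<tau> a)"
    and finite_S: "finite S"
    and hom_determined: "(\<And>u v. \<phi> (u + v) = \<phi> u + \<phi> v) \<Longrightarrow> (\<And>x. x \<in> S \<Longrightarrow> \<phi> x = 0)
          \<Longrightarrow> \<phi> y = (0 :: complex)"
begin

lemma act_centre:
  assumes "\<And>k. w + k = k + w"
  shows "act w a = a"
proof -
  have "\<sigma> w + a + \<tau> (- w) = a + w + - w"
    using assms by (simp add: \<tau>_minus \<sigma>_centre \<tau>_centre)
  then show ?thesis by (simp add: act_def add.assoc)
qed

text \<open>An element \<open>w\<close> of the centre fixes every \<open>a\<close> and is unchanged by conjugation.\<close>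

lemma coef_centre_eq_0:
  assumes D: "D \<in> derivations \<sigma> \<tau>" and "infinite (twisted_conj_class \<sigma> \<tau> a)"
    and w: "\<And>k. w + k = k + w"
  shows "coef \<sigma> D a w = 0"
proof (rule coef_eq_0_if_constant_on_infinite_orbit[OF assms(2)])
  fix h
  have "h + w - h = w" by (simp flip: w)
  with coef_conjugate[OF D act_centre[OF w], of h a]
  show "coef \<sigma> D (act h a) w = coef \<sigma> D a w" by simp
qed

text \<open>
  Conjugating \<open>g\<close> multiplies it by a commutator \<open>c\<close>, which is in the centre; by the previous lemma at
  the other points of the orbit, \<open>c\<close> contributes nothing, so the value at \<open>g\<close> is constant on the orbit.
\<close>

lemma coef_stabiliser_eq_0:
  assumes D: "D \<in> derivations \<sigma> \<tau>" and inf: "infinite (twisted_conj_class \<sigma> \<tau> a)"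
    and fix_a: "act g a = a"
  shows "coef \<sigma> D a g = 0"
proof (rule coef_eq_0_if_constant_on_infinite_orbit[OF inf])
  fix h
  define c where "c = h + g - h - g"
  have c: "c + k = k + c" for k unfolding c_def by (rule commutator_central)
  have "h + g - h = c + g" by (simp add: c_def)
  then have "coef \<sigma> D a g = coef \<sigma> D (act h a) (c + g)"
    using coef_conjugate[OF D fix_a, of h] by simp
  also have "\<dots> = coef \<sigma> D (act (g + h) a) c + coef \<sigma> D (act h a) g"
    by (simp add: coef_add[OF D] act_add)
  also have "coef \<sigma> D (act (g + h) a) c = 0"
    using D inf c by (intro coef_centre_eq_0) (simp_all add: twisted_conj_class_act)
  finally show "coef \<sigma> D (act h a) g = coef \<sigma> D a g" by simp
qed

definition central_part ::
  "('g group_algebra \<Rightarrow> 'g group_algebra) \<Rightarrow> 'g group_algebra \<Rightarrow> 'g group_algebra"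
  where "central_part D = (\<Sum>a | twisted_central \<sigma> \<tau> a \<and> (\<exists>x\<in>S. coef \<sigma> D a x \<noteq> 0).
    central_derivation \<sigma> a (coef \<sigma> D a))"

lemma central_part_ZDer:
  assumes "D \<in> derivations \<sigma> \<tau>"
  shows "central_part D \<in> ZDer \<sigma> \<tau>"
  unfolding central_part_def ZDer_def
  by (rule op.span_sum, rule op.span_base) (use coef_central_hom[OF assms] in blast)

lemma coef_central_part:
  assumes D: "D \<in> derivations \<sigma> \<tau>" and "twisted_central \<sigma> \<tau> a"
  shows "coef \<sigma> (central_part D) a g = coef \<sigma> D a g"
proof -
  let ?A = "{a. twisted_central \<sigma> \<tau> a \<and> (\<exists>x\<in>S. coef \<sigma> D a x \<noteq> 0)}"
  have "finite (\<Union>x\<in>S. {a. coef \<sigma> D a x \<noteq> 0})"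
    using finite_S by (simp add: finite_coef_nonzero)
  then have "finite ?A" by (rule rev_finite_subset) auto
  then have "coef \<sigma> (central_part D) a g = (if a \<in> ?A then coef \<sigma> D a g else 0)"
    by (simp add: central_part_def coef_sum coef_central_derivation)
  also have "\<dots> = coef \<sigma> D a g"
    using hom_determined[of "coef \<sigma> D a" g] coef_central_hom[OF assms] assms(2) by auto
  finally show ?thesis .
qed

lemma minus_central_part_QInn:
  assumes D: "D \<in> derivations \<sigma> \<tau>"
  shows "D - central_part D \<in> QInn \<sigma> \<tau>"
proof -
  let ?E = "D - central_part D"
  have E: "?E \<in> derivations \<sigma> \<tau>"
    using D central_part_ZDer[OF D] ZDer_subset_derivations
    by (auto intro: op.subspace_diff subspace_derivations)
  have "coef \<sigma> ?E a g = 0" if "act g a = a" for a g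
    using central_or_infinite[of a]
  proof
    assume "twisted_central \<sigma> \<tau> a"
    then show ?thesis by (simp add: coef_minus coef_central_part[OF D])
  qed (rule coef_stabiliser_eq_0[OF E _ that])
  with E show ?thesis by (simp add: QInn_iff)
qed

theorem derivations_direct_sum:
  "internal_direct_sum (derivations \<sigma> \<tau>) (ZDer \<sigma> \<tau>) (QInn \<sigma> \<tau>)"
proof -
  have "derivations \<sigma> \<tau> = {D + E | D E. D \<in> ZDer \<sigma> \<tau> \<and> E \<in> QInn \<sigma> \<tau>}"
  proof (intro equalityI subsetI)
    fix D assume D: "D \<in> derivations \<sigma> \<tau>"
    have "D = central_part D + (D - central_part D)" by simp
    with central_part_ZDer[OF D] minus_central_part_QInn[OF D]
    show "D \<in> {D + E | D E. D \<in> ZDer \<sigma> \<tau> \<and> E \<in> QInn \<sigma> \<tau>}" by blast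
  next
    fix F assume "F \<in> {D + E | D E. D \<in> ZDer \<sigma> \<tau> \<and> E \<in> QInn \<sigma> \<tau>}"
    then show "F \<in> derivations \<sigma> \<tau>"
      using ZDer_subset_derivations
      by (auto simp: QInn_iff intro: op.subspace_add[OF subspace_derivations])
  qed
  moreover have "op.subspace (ZDer \<sigma> \<tau>)" unfolding ZDer_def by (rule op.subspace_span)
  ultimately show ?thesis
    by (simp add: internal_direct_sum_def subspace_QInn ZDer_Int_QInn)
qed

end

section \<open>The Heisenberg group in coordinates\<close>

definition hx :: "heis \<Rightarrow> int" where "hx A = Rep_heis A $ 1 $ 2"
definition hy :: "heis \<Rightarrow> int" where "hy A = Rep_heis A $ 2 $ 3"
definition hz :: "heis \<Rightarrow> int" where "hz A = Rep_heis A $ 1 $ 3"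

definition heis_of :: "int \<Rightarrow> int \<Rightarrow> int \<Rightarrow> heis" where
  "heis_of p q r = Abs_heis (\<chi> i j. if i = j then 1 else if i = 1 \<and> j = 2 then p
     else if i = 2 \<and> j = 3 then q else if i = 1 \<and> j = 3 then r else 0)"

lemma Rep_heis_of:
  "Rep_heis (heis_of p q r) = (\<chi> i j. if i = j then 1 else if i = 1 \<and> j = 2 then p
     else if i = 2 \<and> j = 3 then q else if i = 1 \<and> j = 3 then r else 0)"
  unfolding heis_of_def by (subst Abs_heis_inverse) simp_all

lemma heis_of_coords [simp]:
  "hx (heis_of p q r) = p" "hy (heis_of p q r) = q" "hz (heis_of p q r) = r"
  by (simp_all add: hx_def hy_def hz_def Rep_heis_of)

lemma plus_coords [simp]:
  "hx (A + B) = hx A + hx B" "hy (A + B) = hy A + hy B" "hz (A + B) = hz A + hz B + hx A * hy B"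
  using Rep_heis[of A] Rep_heis[of B]
  by (simp_all add: hx_def hy_def hz_def Rep_plus_heis matrix_matrix_mult_def sum_3)

lemma heis_eq_iff: "A = B \<longleftrightarrow> hx A = hx B \<and> hy A = hy B \<and> hz A = hz B"
  using Rep_heis[of A] Rep_heis[of B]
  by (auto simp: Rep_heis_inject[symmetric] vec_eq_iff forall_3 hx_def hy_def hz_def)

lemma zero_coords [simp]: "hx 0 = 0" "hy 0 = 0" "hz 0 = 0"
  by (simp_all add: hx_def hy_def hz_def Rep_zero_heis mat_def)

lemma uminus_coords [simp]: "hx (- A) = - hx A" "hy (- A) = - hy A" "hz (- A) = hx A * hy A - hz A"
proof -
  have 0: "hx (- A) + hx A = 0" "hy (- A) + hy A = 0" "hz (- A) + hz A + hx (- A) * hy A = 0"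
    by (simp_all flip: plus_coords)
  from 0(1,2) show x: "hx (- A) = - hx A" and "hy (- A) = - hy A" by (simp_all only: eq_neg_iff_add_eq_0)
  from 0(3) x show "hz (- A) = hx A * hy A - hz A" by simp
qed

lemma minus_coords [simp]:
  "hx (A - B) = hx A - hx B" "hy (A - B) = hy A - hy B"
  "hz (A - B) = hz A - hz B - (hx A - hx B) * hy B"
  unfolding minus_heis_def plus_coords uminus_coords by (simp_all add: algebra_simps)

lemma hom_heis_eq_0:
  fixes \<phi> :: "heis \<Rightarrow> complex"
  assumes \<phi>: "\<And>u v. \<phi> (u + v) = \<phi> u + \<phi> v"
    and gens: "\<phi> (heis_of 1 0 0) = 0" "\<phi> (heis_of 0 1 0) = 0"
  shows "\<phi> A = 0"
proof -
  have zero: "\<phi> 0 = 0" using \<phi>[of 0 0] by simp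
  have minus: "\<phi> (- u) = - \<phi> u" for u using \<phi>[of "- u" u] zero by (simp add: eq_neg_iff_add_eq_0)
  have diff: "\<phi> (u - v) = \<phi> u - \<phi> v" for u v using \<phi>[of u "- v"] minus by simp
  have x: "\<phi> (heis_of p 0 0) = 0" for p
  proof (induction p rule: int_induct[of _ 0])
    case base
    have "heis_of 0 0 0 = 0" by (simp add: heis_eq_iff)
    with zero show ?case by simp
  next
    case (step1 p)
    have "heis_of (p + 1) 0 0 = heis_of p 0 0 + heis_of 1 0 0" by (simp add: heis_eq_iff)
    with step1 gens \<phi> show ?case by simp
  next
    case (step2 p)
    have "heis_of (p - 1) 0 0 = heis_of p 0 0 - heis_of 1 0 0" by (simp add: heis_eq_iff)
    with step2 gens diff show ?case by simp
  qed
  have y: "\<phi> (heis_of 0 q 0) = 0" for q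
  proof (induction q rule: int_induct[of _ 0])
    case base
    have "heis_of 0 0 0 = 0" by (simp add: heis_eq_iff)
    with zero show ?case by simp
  next
    case (step1 q)
    have "heis_of 0 (q + 1) 0 = heis_of 0 q 0 + heis_of 0 1 0" by (simp add: heis_eq_iff)
    with step1 gens \<phi> show ?case by simp
  next
    case (step2 q)
    have "heis_of 0 (q - 1) 0 = heis_of 0 q 0 - heis_of 0 1 0" by (simp add: heis_eq_iff)
    with step2 gens diff show ?case by simp
  qed
  \<comment> \<open>Elements of the centre are commutators, so they are killed by any homomorphism to an abelian
    group.\<close>
  have z: "\<phi> (heis_of 0 0 r) = 0" for r
  proof -
    have "heis_of 0 0 r = heis_of 1 0 0 + heis_of 0 r 0 - heis_of 1 0 0 - heis_of 0 r 0"
      by (simp add: heis_eq_iff)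
    then show ?thesis by (simp add: \<phi> diff)
  qed
  have "A = heis_of 0 (hy A) 0 + heis_of (hx A) 0 0 + heis_of 0 0 (hz A)"
    by (simp add: heis_eq_iff)
  then have "\<phi> A = \<phi> (heis_of 0 (hy A) 0 + heis_of (hx A) 0 0 + heis_of 0 0 (hz A))" by simp
  then show ?thesis by (simp add: \<phi> x y z)
qed

text \<open>
  With \<open>x = s\<inverse> a t\<close> the twisted class of \<open>a\<close> is the conjugacy class of \<open>x\<close> multiplied by \<open>s\<close> and
  \<open>t\<inverse>\<close>. Conjugating \<open>x = (p, q, r)\<close> by \<open>(k q, - k p, *)\<close> adds \<open>k (p\<^sup>2 + q\<^sup>2)\<close> to \<open>r\<close>.
\<close>

lemma heis_central_or_infinite:
  fixes s t :: heis
  assumes "\<sigma> = inner_automorphism s" and "\<tau> = inner_automorphism t"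
  shows "twisted_central \<sigma> \<tau> a \<or> infinite (twisted_conj_class \<sigma> \<tau> a)"
proof -
  define x where "x = - s + a + t"
  have a: "a = s + x - t" by (simp add: x_def add.assoc)
  show ?thesis
  proof (cases "hx x = 0 \<and> hy x = 0")
    case True
    then have "twisted_central \<sigma> \<tau> a"
      by (simp add: twisted_central_def a assms inner_automorphism_def heis_eq_iff,
          simp add: algebra_simps)
    then show ?thesis ..
  next
    case False
    let ?n = "hx x * hx x + hy x * hy x"
    let ?f = "\<lambda>k. s + (heis_of (k * hy x) (- k * hx x) 0 + x - heis_of (k * hy x) (- k * hx x) 0) - t"
    have n: "?n \<noteq> 0" using False by (simp add: sum_squares_eq_zero_iff)
    have hz: "hz (?f k) = hz (?f 0) + k * ?n" for k
      by (simp add: algebra_simps)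
    have "inj ?f"
    proof (rule injI)
      fix k l assume "?f k = ?f l"
      then have "hz (?f k) = hz (?f l)" by (rule arg_cong)
      then have "k * ?n = l * ?n" unfolding hz[of k] hz[of l] by (rule add_left_imp_eq)
      with n show "k = l" using mult_cancel_right[of k ?n l] by blast
    qed
    then have "infinite (range ?f)" by (simp only: finite_image_iff infinite_UNIV_int not_False_eq_True)
    moreover have "range ?f \<subseteq> twisted_conj_class \<sigma> \<tau> a"
    proof
      fix b assume "b \<in> range ?f"
      then obtain v where "b = s + (v + x - v) - t" by auto
      moreover have "s + (v + x - v) - t = \<sigma> v + a + \<tau> (- v)"
        by (simp add: a assms inner_automorphism_def add.assoc diff_conv_add_uminus
            del: add_uminus_conv_diff)
      ultimately show "b \<in> twisted_conj_class \<sigma> \<tau> a" by (auto simp: twisted_conj_class_def)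
    qed
    ultimately have "infinite (twisted_conj_class \<sigma> \<tau> a)"
      using finite_subset by blast
    then show ?thesis ..
  qed
qed

theorem mainTheorem5:
  fixes s t :: heis and \<sigma> \<tau> :: "heis \<Rightarrow> heis"
  assumes "\<sigma> = inner_automorphism s" and "\<tau> = inner_automorphism t"
  shows "(\<forall>a. card (twisted_conj_class \<sigma> \<tau> a) = 1 \<or> infinite (twisted_conj_class \<sigma> \<tau> a)) \<and>
    internal_direct_sum (derivations \<sigma> \<tau>) (ZDer \<sigma> \<tau>) (QInn \<sigma> \<tau>)"
proof -
  note dichotomy = heis_central_or_infinite[OF assms]
  interpret class_two_twisting \<sigma> \<tau> "{heis_of 1 0 0, heis_of 0 1 0}"
  proof
    show "\<sigma> (u + v) = \<sigma> u + \<sigma> v" "\<tau> (u + v) = \<tau> u + \<tau> v" for u v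
      by (simp_all add: assms inner_automorphism_def add.assoc del: add_uminus_conv_diff)
    show "h + g - h - g + k = k + (h + g - h - g)" for g h k :: heis
      by (simp add: heis_eq_iff)
    have "inner_automorphism u w = w" if "\<And>k. w + k = k + w" for u w :: heis
      unfolding inner_automorphism_def that[of u, symmetric] by (simp add: add.assoc)
    then show "\<sigma> w = w" "\<tau> w = w" if "\<And>k. w + k = k + w" for w
      using that unfolding assms by blast+
    show "\<phi> y = 0" if "\<And>u v. \<phi> (u + v) = \<phi> u + \<phi> v"
      "\<And>x. x \<in> {heis_of 1 0 0, heis_of 0 1 0} \<Longrightarrow> \<phi> x = 0" for \<phi> :: "heis \<Rightarrow> complex" and y
      by (rule hom_heis_eq_0) (use that in blast)+
  qed (rule dichotomy, simp)
  have "card (twisted_conj_class \<sigma> \<tau> a) = 1 \<or> infinite (twisted_conj_class \<sigma> \<tau> a)" for a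
    using dichotomy[of a] by (auto simp: twisted_conj_class_central)
  with derivations_direct_sum show ?thesis by blast
qed

end
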